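(* Let $f(n)$ be an arithmetic function for which a linear asymptotic with an estimate of the remainder term is known: $$\sum_{n\le x} f(n)=cx+O(g(x)),\qquad x\to\infty,$$ where $c\neq 0$. Then $$\sum_{n\le x} n f(n)=\frac{c x^2}{2}+O(x g(x))+O\left(\int_1^x g(t)\,dt\right)+O(1),\qquad x\to\infty.$$
   Context: An arithmetic function is a function defined on the positive integers with complex values. Sums $\sum_{n\le x}$ run over positive integers $n\le x$. Here $c$ is a constant and $g$ is the function appearing in the remainder term. $O(\cdot)$ is the usual Landau symbol as $x\to\infty$. *)

theory Defs
  imports "HOL-Analysis.Analysis" "HOL-Library.Landau_Symbols"
begin

end

(* Abel summation: the sum of n f(n) over n <= x equals x S(x) minus the integral of S over [1, x],
   where S(x) is the sum of f(n) over n <= x. Writing S(t) = c t + R(t), the main part contributes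
   c x^2 / 2 + c / 2 and the rest is x R(x) minus the integral of R over [1, x]. The last integral
   is at most a constant plus a multiple of the integral of g, from the point on where g is
   nonnegative and |R| <= C g. *)

theory Submission imports Defs begin

lemma finite_nat_real_le: "finite {n::nat. 1 \<le> n \<and> real n \<le> x}"
  by (rule finite_subset[of _ "{..nat \<lfloor>x\<rfloor>}"]) (auto simp: le_nat_floor)

text \<open>Each term \<open>f n\<close> enters the partial sum as a step function that switches on
  at t = n, so it contributes (x - n) \<open>f n\<close> to the integral over [1, x]. Since only
  finitely many n matter, integration is termwise. The resulting weighted sum is x S(x) minus the
  sum of n f(n), which is where Abel summation comes from.\<close>

lemma has_integral_partial_sums:
  fixes f :: "nat \<Rightarrow> 'a::euclidean_space"
  assumes "1 \<le> x"
  shows "((\<lambda>t. \<Sum>n | 1 \<le> n \<and> real n \<le> t. f n) has_integral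
           (\<Sum>n | 1 \<le> n \<and> real n \<le> x. (x - real n) *\<^sub>R f n)) {1..x}"
proof -
  let ?N = "{n::nat. 1 \<le> n \<and> real n \<le> x}"
  have piece: "((\<lambda>t. if t \<in> {real n..x} then f n else 0) has_integral (x - real n) *\<^sub>R f n) {1..x}"
    if "n \<in> ?N" for n
  proof -
    have "{real n..x} \<subseteq> {1..x}" using that by auto
    moreover have "((\<lambda>t. f n) has_integral (x - real n) *\<^sub>R f n) {real n..x}"
      using has_integral_const_real[of "f n" "real n" x] that by simp
    ultimately show ?thesis by (subst has_integral_restrict)
  qed
  \<comment> \<open>The index set \<open>?N\<close> depends on x only, so the sum can be integrated
    term by term; for t in [1, x] the indicators cut it down to the indices n up to t.\<close>
  have eq: "(\<Sum>n\<in>?N. if t \<in> {real n..x} then f n else 0) = (\<Sum>n | 1 \<le> n \<and> real n \<le> t. f n)"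
    if "t \<in> {1..x}" for t
  proof -
    have "(\<Sum>n\<in>?N. if t \<in> {real n..x} then f n else 0) = sum f {n\<in>?N. t \<in> {real n..x}}"
      by (rule sum.inter_filter[symmetric]) (rule finite_nat_real_le)
    also have "{n\<in>?N. t \<in> {real n..x}} = {n. 1 \<le> n \<and> real n \<le> t}"
      using that by auto
    finally show ?thesis .
  qed
  have "((\<lambda>t. \<Sum>n\<in>?N. if t \<in> {real n..x} then f n else 0) has_integral
          (\<Sum>n\<in>?N. (x - real n) *\<^sub>R f n)) {1..x}"
    by (rule has_integral_sum[OF finite_nat_real_le piece])
  then show ?thesis
    by (rule has_integral_eq[rotated]) (rule eq)
qed

lemma has_integral_of_real_linear:
  assumes "1 \<le> x"
  shows "((\<lambda>t. c * complex_of_real t) has_integral c * of_real ((x\<^sup>2 - 1) / 2)) {1..x}"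
proof -
  have "((\<lambda>t::real. t) has_integral (x\<^sup>2 - 1) / 2) {1..x}"
    using ident_has_integral[OF assms] by (simp add: diff_divide_distrib)
  then have "((\<lambda>t. complex_of_real t) has_integral of_real ((x\<^sup>2 - 1) / 2)) {1..x}"
    by (rule has_integral_of_real)
  then show ?thesis by (rule has_integral_mult_right)
qed

text \<open>The integrals are split at a point X beyond which the bound holds. What happens on
  [1, X] does not depend on x and is absorbed into \<open>B\<close>. As \<open>g\<close> may have
  any sign on [1, X], absolute values of its integrals are used.\<close>

lemma integral_bound_of_eventual_bound:
  fixes R :: "real \<Rightarrow> 'a::euclidean_space"
  assumes R: "\<And>x. 1 \<le> x \<Longrightarrow> R integrable_on {1..x}"
    and g: "\<And>x. 1 \<le> x \<Longrightarrow> g integrable_on {1..x}"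
    and bound: "\<forall>\<^sub>F x in at_top. norm (R x) \<le> C * g x"
    and C: "0 < C"
  obtains B where "0 < B"
    "\<forall>\<^sub>F x in at_top. norm (integral {1..x} R) \<le> C * \<bar>integral {1..x} g\<bar> + B"
proof -
  obtain X0 where X0: "\<And>x. x \<ge> X0 \<Longrightarrow> norm (R x) \<le> C * g x"
    using bound by (auto simp: eventually_at_top_linorder)
  \<comment> \<open>The maximum keeps the splitting point inside the range of integration; the
    summand 1 in \<open>B\<close> makes it strictly positive.\<close>
  define X where "X = max 1 X0"
  define B where "B = norm (integral {1..X} R) + C * \<bar>integral {1..X} g\<bar> + 1"
  have X: "1 \<le> X" by (simp add: X_def)
  have "norm (integral {1..x} R) \<le> C * \<bar>integral {1..x} g\<bar> + B" if "X \<le> x" for x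
  proof -
    have x: "1 \<le> x" using X that by simp
    have sub: "{X..x} \<subseteq> {1..x}" using X by auto
    have RX: "R integrable_on {X..x}" and gX: "g integrable_on {X..x}"
      using integrable_on_subinterval[OF R[OF x] sub] integrable_on_subinterval[OF g[OF x] sub]
      by auto
    have splitR: "integral {1..X} R + integral {X..x} R = integral {1..x} R"
      by (rule Henstock_Kurzweil_Integration.integral_combine[OF X that R[OF x]])
    have splitg: "integral {1..X} g + integral {X..x} g = integral {1..x} g"
      by (rule Henstock_Kurzweil_Integration.integral_combine[OF X that g[OF x]])
    have "norm (integral {X..x} R) \<le> integral {X..x} (\<lambda>t. C * g t)"
      using RX integrable_on_mult_right[OF gX]
      by (rule integral_norm_bound_integral) (use X0 in \<open>auto simp: X_def\<close>)
    also have "\<dots> = C * integral {1..x} g - C * integral {1..X} g"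
      using splitg by (simp flip: right_diff_distrib)
    also have "\<dots> \<le> C * \<bar>integral {1..x} g\<bar> + C * \<bar>integral {1..X} g\<bar>"
      using C by (simp flip: right_diff_distrib distrib_left)
    finally show ?thesis
      using norm_triangle_ineq[of "integral {1..X} R" "integral {X..x} R"] splitR
      by (simp add: B_def)
  qed
  then have "\<forall>\<^sub>F x in at_top. norm (integral {1..x} R) \<le> C * \<bar>integral {1..x} g\<bar> + B"
    by (auto simp: eventually_at_top_linorder)
  moreover have "0 < B" using C by (simp add: B_def add_nonneg_pos)
  ultimately show thesis using that by blast
qed

text \<open>At each point the whole value of \<open>D\<close> goes to one of the two parts. If it is
  at most 2 C |h|, it goes to \<open>E2\<close>. Otherwise C |h| is less than half of |D|, so the
  assumed bound forces |D| < 2 B and the value goes to \<open>E3\<close>.\<close>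

lemma bigo_add_const_split:
  fixes D :: "'a \<Rightarrow> complex" and h :: "'a \<Rightarrow> real"
  assumes bound: "\<forall>\<^sub>F x in F. norm (D x) \<le> C * \<bar>h x\<bar> + B"
  obtains E2 E3 where "E2 \<in> O[F](\<lambda>x. of_real (h x))" "E3 \<in> O[F](\<lambda>x. 1)"
    "\<And>x. D x = E2 x + E3 x"
proof -
  let ?small = "\<lambda>x. norm (D x) \<le> 2 * C * \<bar>h x\<bar>"
  \<comment> \<open>No sign is assumed for \<open>C\<close>; a nonnegative constant also covers the
    branch where the value is 0.\<close>
  have "norm (if ?small x then D x else 0) \<le> (2 * \<bar>C\<bar> + 1) * norm (complex_of_real (h x))" for x
  proof -
    have "2 * C * \<bar>h x\<bar> \<le> (2 * \<bar>C\<bar> + 1) * \<bar>h x\<bar>"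
      by (rule mult_right_mono) auto
    then show ?thesis by auto
  qed
  then have E2: "(\<lambda>x. if ?small x then D x else 0) \<in> O[F](\<lambda>x. of_real (h x))"
    by (intro bigoI always_eventually allI)
  have "\<forall>\<^sub>F x in F. norm (if ?small x then 0 else D x) \<le> 2 * \<bar>B\<bar> * norm (1::complex)"
    using bound by eventually_elim auto
  then have E3: "(\<lambda>x. if ?small x then 0 else D x) \<in> O[F](\<lambda>x. 1)"
    by (rule bigoI)
  have "D x = (if ?small x then D x else 0) + (if ?small x then 0 else D x)" for x
    by simp
  with E2 E3 show thesis by (rule that)
qed

theorem mainTheorem2:
  fixes f :: "nat \<Rightarrow> complex" and c :: complex and g :: "real \<Rightarrow> real"
  assumes c_nonzero: "c \<noteq> 0"
    and g_nonneg: "\<forall>\<^sub>F x in at_top. 0 \<le> g x"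
    and g_integrable: "\<And>x. x \<ge> 1 \<Longrightarrow> g integrable_on {1..x}"
    and asymptotic:
      "(\<lambda>x::real. (\<Sum>n | 1 \<le> n \<and> real n \<le> x. f n) - c * of_real x)
         \<in> O[at_top](\<lambda>x. of_real (g x))"
  shows "\<exists>E1 E2 E3 :: real \<Rightarrow> complex.
      E1 \<in> O[at_top](\<lambda>x. of_real (x * g x)) \<and>
      E2 \<in> O[at_top](\<lambda>x. of_real (integral {1..x} g)) \<and>
      E3 \<in> O[at_top](\<lambda>x. 1) \<and>
      (\<forall>x\<ge>1. (\<Sum>n | 1 \<le> n \<and> real n \<le> x. of_nat n * f n)
              = c * of_real (x ^ 2) / 2 + E1 x + E2 x + E3 x)"
proof -
  define S where "S x = (\<Sum>n | 1 \<le> n \<and> real n \<le> x. f n)" for x :: real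
  define R where "R x = S x - c * of_real x" for x
  have R_int: "(R has_integral (\<Sum>n | 1 \<le> n \<and> real n \<le> x. (x - real n) *\<^sub>R f n)
                  - c * of_real ((x\<^sup>2 - 1) / 2)) {1..x}" if "1 \<le> x" for x
    unfolding R_def S_def
    by (intro has_integral_diff has_integral_partial_sums has_integral_of_real_linear that)
  have R_bigo: "R \<in> O[at_top](\<lambda>x. of_real (g x))"
    using asymptotic by (simp add: R_def[abs_def] S_def)
  then obtain C where C: "0 < C" "\<forall>\<^sub>F x in at_top. norm (R x) \<le> C * norm (complex_of_real (g x))"
    by (elim landau_o.bigE)
  \<comment> \<open>Eventual nonnegativity of \<open>g\<close> removes the absolute value, so that
    integrating the bound yields the integral of \<open>g\<close> itself.\<close>
  have R_le: "\<forall>\<^sub>F x in at_top. norm (R x) \<le> C * g x"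
    using C(2) g_nonneg by eventually_elim simp
  have "R integrable_on {1..x}" if "1 \<le> x" for x
    using R_int[OF that] by (rule has_integral_integrable)
  from this g_integrable R_le C(1) obtain B where
    "\<forall>\<^sub>F x in at_top. norm (integral {1..x} R) \<le> C * \<bar>integral {1..x} g\<bar> + B"
    by (rule integral_bound_of_eventual_bound)
  then have "\<forall>\<^sub>F x in at_top. norm (- integral {1..x} R) \<le> C * \<bar>integral {1..x} g\<bar> + B"
    by simp
  then obtain E2 E3 where
    E2: "E2 \<in> O[at_top](\<lambda>x. of_real (integral {1..x} g))" and
    E3: "E3 \<in> O[at_top](\<lambda>x. 1)" and
    split: "\<And>x. - integral {1..x} R = E2 x + E3 x"
    by (rule bigo_add_const_split) (rule that)
  \<comment> \<open>The extra c / 2 comes from the lower limit 1 in the integral of c t, and it is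
    counted in the bounded term. The identity holds for every x from 1 on because
    \<open>split\<close> is pointwise.\<close>
  have "(\<Sum>n | 1 \<le> n \<and> real n \<le> x. of_nat n * f n)
          = c * of_real (x ^ 2) / 2 + of_real x * R x + E2 x + (E3 x + c / 2)" if "1 \<le> x" for x
  proof -
    have "(\<Sum>n | 1 \<le> n \<and> real n \<le> x. (x - real n) *\<^sub>R f n)
        = of_real x * S x - (\<Sum>n | 1 \<le> n \<and> real n \<le> x. of_nat n * f n)"
      by (simp add: S_def scaleR_conv_of_real left_diff_distrib sum_subtractf sum_distrib_left)
    moreover have "- (E2 x + E3 x) = (\<Sum>n | 1 \<le> n \<and> real n \<le> x. (x - real n) *\<^sub>R f n)
                  - c * of_real ((x\<^sup>2 - 1) / 2)"
      unfolding split[symmetric] minus_minus by (rule integral_unique[OF R_int[OF that]])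
    ultimately have "- (E2 x + E3 x) = of_real x * S x
        - (\<Sum>n | 1 \<le> n \<and> real n \<le> x. of_nat n * f n) - c * of_real ((x\<^sup>2 - 1) / 2)"
      by (simp only:)
    then have sum_eq: "(\<Sum>n | 1 \<le> n \<and> real n \<le> x. of_nat n * f n)
        = of_real x * S x - c * of_real ((x\<^sup>2 - 1) / 2) + (E2 x + E3 x)"
      by algebra
    show ?thesis
      unfolding sum_eq by (simp add: R_def field_simps power2_eq_square)
  qed
  moreover have "(\<lambda>x. of_real x * R x) \<in> O[at_top](\<lambda>x. of_real (x * g x))"
    using landau_o.big.mult_left[OF R_bigo, of of_real] by simp
  moreover have "(\<lambda>x. E3 x + c / 2) \<in> O[at_top](\<lambda>x. 1)"
    by (intro sum_in_bigo E3) simp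
  ultimately show ?thesis using E2 by blast
qed

end
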